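(* Let $\alpha,\beta,x,y,p\in\mathbb{C}$ with $\mathrm{Re}(x)>0$, $\mathrm{Re}(y)>0$, $\mathrm{Re}(\alpha)>-1$, $\mathrm{Re}(p)>0$. Then the $\Psi$-beta function has the integral representations $${}^{\Psi}B_{p}^{(\alpha,\beta)}(x,y)=2\int_{0}^{\frac{\pi}{2}} \cos^{2x-1}(\theta)\, \sin^{2y-1}(\theta)\;{}_{0}\Psi_{1}\left( \alpha,\beta;-p \sec^{2}(\theta) \csc^{2}(\theta)\right)d\theta,$$ $${}^{\Psi}B_{p}^{(\alpha,\beta)}(x,y)=\int_{0}^{\infty}\frac{u^{x-1}}{(1+u)^{x+y}}\;{}_{0}\Psi_{1}\left( \alpha,\beta;-2p-p\left( u+\frac{1}{u}\right) \right)du.$$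
   Context: For $\alpha,\beta\in\mathbb{C}$ with $\mathrm{Re}(\alpha)>-1$, the Wright function is ${}_{0}\Psi_{1}(\alpha,\beta;z)=\sum_{n=0}^{\infty}\frac{1}{\Gamma(\alpha n+\beta)}\frac{z^n}{n!}$ (with $1/\Gamma$ equal to $0$ at the poles of $\Gamma$). For $\mathrm{Re}(x)>0$, $\mathrm{Re}(y)>0$, $\mathrm{Re}(\alpha)>-1$, $\mathrm{Re}(p)>0$ the $\Psi$-beta function is $${}^{\Psi}B_{p}^{(\alpha,\beta)}(x,y)=\int_{0}^{1}t^{x-1}(1-t)^{y-1}\,{}_{0}\Psi_{1}\left(\alpha,\beta;-\frac{p}{t(1-t)}\right)dt.$$ *)

theory Defs
  imports "HOL-Analysis.Analysis"
begin

text \<open>The library function \<open>rGamma\<close> is the entire function \<open>1 / \<Gamma>\<close>; in particular it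
  vanishes at the poles of \<open>\<Gamma>\<close>. The series converges for all \<open>z\<close> if \<open>Re \<alpha> > -1\<close>.\<close>

definition wright_psi :: "complex \<Rightarrow> complex \<Rightarrow> complex \<Rightarrow> complex" where
  "wright_psi \<alpha> \<beta> z = (\<Sum>n. rGamma (\<alpha> * of_nat n + \<beta>) * (z ^ n / fact n))"

definition Psi_beta_integrand ::
    "complex \<Rightarrow> complex \<Rightarrow> complex \<Rightarrow> complex \<Rightarrow> complex \<Rightarrow> real \<Rightarrow> complex" where
  "Psi_beta_integrand p \<alpha> \<beta> x y t =
     of_real t powr (x - 1) * of_real (1 - t) powr (y - 1)
       * wright_psi \<alpha> \<beta> (- p / of_real (t * (1 - t)))"

text \<open>All integrals are gauge (Henstock--Kurzweil) integrals, which extend both the Lebesgue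
  integral and the improper Riemann integral; depending on the parameters, the integrals below
  may converge only conditionally. Note that \<open>integral\<close> is \<open>0\<close> for non-integrable functions,
  so that its value is meaningful only together with integrability.\<close>

definition Psi_beta ::
    "complex \<Rightarrow> complex \<Rightarrow> complex \<Rightarrow> complex \<Rightarrow> complex \<Rightarrow> complex" where
  "Psi_beta p \<alpha> \<beta> x y = integral {0<..<1} (Psi_beta_integrand p \<alpha> \<beta> x y)"

definition Psi_beta_trig_integrand ::
    "complex \<Rightarrow> complex \<Rightarrow> complex \<Rightarrow> complex \<Rightarrow> complex \<Rightarrow> real \<Rightarrow> complex" where
  "Psi_beta_trig_integrand p \<alpha> \<beta> x y \<theta> =
     of_real (cos \<theta>) powr (2 * x - 1) * of_real (sin \<theta>) powr (2 * y - 1)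
       * wright_psi \<alpha> \<beta> (- p * of_real ((1 / cos \<theta>)\<^sup>2 * (1 / sin \<theta>)\<^sup>2))"

definition Psi_beta_halfline_integrand ::
    "complex \<Rightarrow> complex \<Rightarrow> complex \<Rightarrow> complex \<Rightarrow> complex \<Rightarrow> real \<Rightarrow> complex" where
  "Psi_beta_halfline_integrand p \<alpha> \<beta> x y u =
     of_real u powr (x - 1) / of_real (1 + u) powr (x + y)
       * wright_psi \<alpha> \<beta> (- 2 * p - p * of_real (u + 1 / u))"

end

theory Submission
  imports Defs "HOL-Real_Asymp.Real_Asymp"
begin

text \<open>
  Both representations are changes of variables. With \<open>t = cos\<^sup>2 \<theta>\<close> one has
  \<open>t (1 - t) = cos\<^sup>2 \<theta> sin\<^sup>2 \<theta>\<close> and \<open>\<bar>dt\<bar> = 2 sin \<theta> cos \<theta> d\<theta>\<close>, and with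
  \<open>t = u / (1 + u)\<close> one has \<open>1 / (t (1 - t)) = (1 + u)\<^sup>2 / u = 2 + u + 1 / u\<close> and
  \<open>dt = du / (1 + u)\<^sup>2\<close>; what remains is bookkeeping with complex powers of positive reals
  (\<open>trig_integrand_eq\<close>, \<open>halfline_integrand_eq\<close>).

  The work lies in justifying the substitution for gauge integrals that may converge only
  conditionally. Both directions are needed, since the two sides must be integrable
  simultaneously. The rule is proved here for arbitrary integrands
  (\<open>has_integral_substitution_increasing_iff\<close>): by Henstock's lemma the terms
  \<open>f(x) (v - u)\<close> of a fine Riemann sum for \<open>f\<close> are close, in the sum of absolute values, to the
  increments of the indefinite integral \<open>F\<close>. A strictly increasing \<open>h\<close> carries tagged divisions to
  tagged divisions, and near a tag \<open>s\<close> an interval is stretched by the factor \<open>h'(s)\<close>, up to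
  an error whose product with \<open>\<bar>f(h(s))\<bar>\<close> the gauge makes as small as desired relative to the length
  of the interval. Hence the Riemann
  sums of \<open>h' (f \<circ> h)\<close> are close to the increments of \<open>F \<circ> h\<close>. The converse is the same statement
  for the inverse of \<open>h\<close>.

  The trigonometric substitution maps a bounded interval to a bounded interval, so this rule
  suffices. For the half-line, the rule applies on every \<open>(0, T)\<close>, and one lets \<open>T\<close> tend to infinity
  on one side and \<open>t = T / (1 + T)\<close> tend to \<open>1\<close> on the other. On the bounded side this passage to
  the limit is Hake's theorem (\<open>has_integral_Ioo_iff_improper\<close>): the gauge integral contains its own
  improper integrals.
\<close>

section \<open>Gauge integrals from primitives\<close>

lemma tagged_division_interval:
  fixes a b :: real
  assumes "p tagged_division_of {a..b}" "(x, K) \<in> p"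
  obtains u v where "K = {u..v}" "u \<le> x" "x \<le> v" "a \<le> u" "v \<le> b" "Inf K = u" "Sup K = v"
    "measure lborel K = v - u"
proof -
  have p: "p tagged_division_of cbox a b"
    using assms(1) by simp
  obtain u v where K: "K = {u..v}"
    using tagged_division_ofD(4)[OF p assms(2)] by auto
  have "x \<in> K" "K \<subseteq> {a..b}"
    using tagged_division_ofD(2,3)[OF p assms(2)] by auto
  then have "u \<le> x" "x \<le> v" "a \<le> u" "v \<le> b"
    using K by auto
  with K that show thesis by auto
qed

text \<open>An endpoint of \<open>{a..b}\<close> can be the tag of only one nondegenerate interval of a tagged division,
  because two such intervals would overlap next to it. So a term that is small for each interval
  contributes little in total over all intervals tagged by that endpoint.\<close>

lemma sum_endpoint_tags_le:
  fixes a b :: real and W :: "real set \<Rightarrow> real"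
  assumes p: "p tagged_division_of {a..b}" and z: "z = a \<or> z = b" and "B \<ge> 0"
    and W: "\<And>K. (z, K) \<in> p \<Longrightarrow> W K \<le> B"
    and W0: "\<And>u. W {u} = 0"
  shows "(\<Sum>(x,K) \<in> {q \<in> p. fst q = z}. W K) \<le> B"
proof -
  define A where "A = {q \<in> p. fst q = z \<and> interior (snd q) \<noteq> {}}"
  have fin: "finite p"
    using p by (rule tagged_division_of_finite)
  have eq: "(\<Sum>(x,K) \<in> {q \<in> p. fst q = z}. W K) = (\<Sum>(x,K) \<in> A. W K)"
  proof (rule sum.mono_neutral_right)
    show "\<forall>q \<in> {q \<in> p. fst q = z} - A. (case q of (x, K) \<Rightarrow> W K) = 0"
    proof
      fix q assume q: "q \<in> {q \<in> p. fst q = z} - A"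
      obtain x K where xK: "q = (x, K)" by (cases q)
      have "q \<in> p" using q by blast
      then have "(x, K) \<in> p" using xK by simp
      from tagged_division_interval[OF p this] obtain u v where K: "K = {u..v}" "u \<le> x" "x \<le> v"
        by metis
      with q xK have "u = v" by (auto simp: A_def interior_atLeastAtMost_real)
      with K W0 xK show "(case q of (x, K) \<Rightarrow> W K) = 0" by simp
    qed
  qed (use fin in \<open>auto simp: A_def\<close>)
  have unique: "q = r" if "q \<in> A" "r \<in> A" for q r
  proof (rule ccontr)
    assume "q \<noteq> r"
    obtain K L where q: "q = (z, K)" "r = (z, L)" "(z, K) \<in> p" "(z, L) \<in> p"
      "interior K \<noteq> {}" "interior L \<noteq> {}"
    proof -
      have "fst q = z" "fst r = z" "q \<in> p" "r \<in> p"
        "interior (snd q) \<noteq> {}" "interior (snd r) \<noteq> {}"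
        using \<open>q \<in> A\<close> \<open>r \<in> A\<close> by (auto simp: A_def)
      moreover from this have "(z, snd q) = q" "(z, snd r) = r"
        by (simp_all add: prod_eq_iff)
      ultimately show thesis
        using that[of "snd q" "snd r"] by simp
    qed
    obtain u v where K: "K = {u..v}" "u \<le> z" "z \<le> v" "a \<le> u" "v \<le> b"
      using tagged_division_interval[OF p q(3)] by metis
    obtain u' v' where L: "L = {u'..v'}" "u' \<le> z" "z \<le> v'" "a \<le> u'" "v' \<le> b"
      using tagged_division_interval[OF p q(4)] by metis
    have "interior K \<inter> interior L = {}"
      using tagged_division_ofD(5)[OF p q(3,4)] \<open>q \<noteq> r\<close> q by blast
    moreover have "u < v" "u' < v'"
      using q K L by (auto simp: interior_atLeastAtMost_real)
    \<comment> \<open>If \<open>z = a\<close>, both intervals start at \<open>a\<close>; if \<open>z = b\<close>, both end at \<open>b\<close>. The midpoint of the shorter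
      one lies inside both.\<close>
    then have "(if z = a then (a + min v v') / 2 else (b + max u u') / 2) \<in> {u<..<v} \<inter> {u'<..<v'}"
      using K L z by (auto simp: min_def max_def field_simps)
    ultimately show False
      using K L by (auto simp: interior_atLeastAtMost_real)
  qed
  show ?thesis
  proof (cases "A = {}")
    case True
    then show ?thesis using eq \<open>B \<ge> 0\<close> by simp
  next
    case False
    then obtain q where "A = {q}" using unique by blast
    then have sum: "(\<Sum>(x,K) \<in> A. W K) = W (snd q)"
      by (simp add: case_prod_unfold)
    have "q \<in> A" using \<open>A = {q}\<close> by simp
    then have "fst q = z" "q \<in> p" by (simp_all add: A_def)
    moreover from this have "(z, snd q) = q" by (simp add: prod_eq_iff)
    ultimately show ?thesis
      using eq sum W[of "snd q"] by simp
  qed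
qed

text \<open>A criterion for \<open>F\<close> to be an indefinite integral of \<open>f\<close>: over the intervals with interior tags,
  the Riemann terms must approximate the increments of \<open>F\<close> in the sum of absolute values. The
  increments telescope over a full division, and the intervals tagged by \<open>a\<close> or \<open>b\<close> contribute
  little because \<open>F\<close> is continuous there.\<close>

lemma has_integral_Ioo_primitive:
  fixes f F :: "real \<Rightarrow> 'a::euclidean_space"
  assumes "a < b" and F: "continuous_on {a..b} F"
    and est: "\<And>e. e > 0 \<Longrightarrow> \<exists>\<gamma>. gauge \<gamma> \<and> (\<forall>p. p tagged_division_of {a..b} \<longrightarrow> 
       \<gamma> fine {q \<in> p. fst q \<in> {a<..<b}} \<longrightarrow>
       (\<Sum>(x,K) \<in> {q \<in> p. fst q \<in> {a<..<b}}. norm (measure lborel K *\<^sub>R f x - (F (Sup K) - F (Inf K)))) \<le> e)"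
  shows "(f has_integral F b - F a) {a<..<b}"
proof -
  \<comment> \<open>Changing \<open>f\<close> to \<open>0\<close> at the endpoints leaves the integral unchanged and removes the Riemann terms
    there.\<close>
  define f0 where "f0 x = (if x \<in> {a<..<b} then f x else 0)" for x
  have "(f0 has_integral F b - F a) (cbox a b)"
    unfolding has_integral
  proof (intro allI impI)
    fix e :: real assume "e > 0"
    then have e4: "e / 4 > 0" by simp
    from est[OF e4] obtain \<gamma> where "gauge \<gamma>" and \<gamma>:
      "\<And>p. p tagged_division_of {a..b} \<Longrightarrow> \<gamma> fine {q \<in> p. fst q \<in> {a<..<b}} \<Longrightarrow>
       (\<Sum>(x,K) \<in> {q \<in> p. fst q \<in> {a<..<b}}. norm (measure lborel K *\<^sub>R f x - (F (Sup K) - F (Inf K)))) \<le> e / 4"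
      by blast
    obtain d1 where d1: "d1 > 0" "\<And>t. t \<in> {a..b} \<Longrightarrow> dist t a < d1 \<Longrightarrow> dist (F t) (F a) < e / 4"
    proof -
      have "a \<in> {a..b}" using \<open>a < b\<close> by simp
      with F e4 that show thesis unfolding continuous_on_iff by blast
    qed
    obtain d2 where d2: "d2 > 0" "\<And>t. t \<in> {a..b} \<Longrightarrow> dist t b < d2 \<Longrightarrow> dist (F t) (F b) < e / 4"
    proof -
      have "b \<in> {a..b}" using \<open>a < b\<close> by simp
      with F e4 that show thesis unfolding continuous_on_iff by blast
    qed
    define \<delta> where "\<delta> x = (if x \<in> {a<..<b} then \<gamma> x else ball x (min d1 d2))" for x
    have "gauge \<delta>"
      using \<open>gauge \<gamma>\<close> d1 d2 by (auto simp: gauge_def \<delta>_def)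
    have small: "norm ((\<Sum>(x,K)\<in>p. measure lborel K *\<^sub>R f0 x) - (F b - F a)) < e"
      if "p tagged_division_of cbox a b" and fine: "\<delta> fine p" for p
    proof -
      have p: "p tagged_division_of {a..b}" using that by simp
      have fin: "finite p" using p by (rule tagged_division_of_finite)
      let ?T = "\<lambda>(x,K). norm (measure lborel K *\<^sub>R f0 x - (F (Sup K) - F (Inf K)))"
      let ?I = "{q \<in> p. fst q \<in> {a<..<b}}"
      let ?A = "{q \<in> p. fst q = a}"
      let ?B = "{q \<in> p. fst q = b}"
      have "fst q \<in> {a..b}" if "q \<in> p" for q
        using that tag_in_interval[OF p] by (metis prod.collapse)
      then have split: "p = ?I \<union> (?A \<union> ?B)" by force
      have "(\<Sum>(x,K)\<in>p. measure lborel K *\<^sub>R f0 x) - (F b - F a) =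
          (\<Sum>(x,K)\<in>p. measure lborel K *\<^sub>R f0 x - (F (Sup K) - F (Inf K)))"
        using additive_tagged_division_1[of a b p F] p \<open>a < b\<close>
        by (simp add: sum_subtractf case_prod_unfold)
      also have "norm \<dots> \<le> (\<Sum>q\<in>p. ?T q)"
        by (rule sum_norm_le) (auto split: prod.splits)
      also have "\<dots> = sum ?T ?I + (sum ?T ?A + sum ?T ?B)"
      proof -
        have "sum ?T p = sum ?T ?I + sum ?T (?A \<union> ?B)"
          by (subst split, rule sum.union_disjoint) (use fin in auto)
        also have "sum ?T (?A \<union> ?B) = sum ?T ?A + sum ?T ?B"
          by (rule sum.union_disjoint) (use fin \<open>a < b\<close> in auto)
        finally show ?thesis .
      qed
      also have "sum ?T ?I \<le> e / 4"
      proof -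
        have "\<gamma> fine ?I"
          using fine unfolding fine_def \<delta>_def by force
        from \<gamma>[OF p this] show ?thesis
          by (rule order_trans[rotated]) (auto simp: f0_def intro!: sum_mono)
      qed
      also have "sum ?T ?A \<le> e / 4"
      proof -
        have "sum ?T ?A = (\<Sum>(x,K)\<in>?A. norm (F (Sup K) - F (Inf K)))"
          by (rule sum.cong) (auto simp: f0_def norm_minus_commute)
        also have "\<dots> \<le> e / 4"
        proof (rule sum_endpoint_tags_le[OF p])
          fix K assume K: "(a, K) \<in> p"
          then obtain u v where "u \<le> a" "a \<le> v" "a \<le> u" "v \<le> b" "Inf K = u" "Sup K = v" "K = {u..v}"
            using tagged_division_interval[OF p] by metis
          moreover have "K \<subseteq> \<delta> a"
            using fine K unfolding fine_def by blast
          then have "K \<subseteq> ball a (min d1 d2)"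
            by (simp add: \<delta>_def)
          ultimately show "norm (F (Sup K) - F (Inf K)) \<le> e / 4"
            using d1(2)[of v] by (auto simp: dist_norm subset_iff dist_commute less_imp_le)
        qed (use e4 in auto)
        finally show ?thesis .
      qed
      also have "sum ?T ?B \<le> e / 4"
      proof -
        have "sum ?T ?B = (\<Sum>(x,K)\<in>?B. norm (F (Sup K) - F (Inf K)))"
          by (rule sum.cong) (auto simp: f0_def norm_minus_commute)
        also have "\<dots> \<le> e / 4"
        proof (rule sum_endpoint_tags_le[OF p])
          fix K assume K: "(b, K) \<in> p"
          then obtain u v where "u \<le> b" "b \<le> v" "a \<le> u" "v \<le> b" "Inf K = u" "Sup K = v" "K = {u..v}"
            using tagged_division_interval[OF p] by metis
          moreover have "K \<subseteq> \<delta> b"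
            using fine K unfolding fine_def by blast
          then have "K \<subseteq> ball b (min d1 d2)"
            by (simp add: \<delta>_def)
          ultimately show "norm (F (Sup K) - F (Inf K)) \<le> e / 4"
            using d2(2)[of u] by (auto simp: dist_norm subset_iff norm_minus_commute less_imp_le)
        qed (use e4 in auto)
        finally show ?thesis .
      qed
      finally show ?thesis using \<open>e > 0\<close> by simp
    qed
    show "\<exists>\<delta>. gauge \<delta> \<and> (\<forall>p. p tagged_division_of cbox a b \<and> \<delta> fine p \<longrightarrow>
        norm ((\<Sum>(x,K)\<in>p. measure lborel K *\<^sub>R f0 x) - (F b - F a)) < e)"
    proof (intro exI[of _ \<delta>] conjI allI impI)
      show "gauge \<delta>" by fact
    qed (rule small; simp)
  qed
  then have "(f0 has_integral F b - F a) {a<..<b}"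
    by (simp add: has_integral_Icc_iff_Ioo)
  then show ?thesis
    by (rule has_integral_eq[rotated]) (simp add: f0_def)
qed

lemma integral_Icc_diff:
  fixes f :: "real \<Rightarrow> 'a::banach"
  assumes "f integrable_on {a..b}" "a \<le> u" "u \<le> v" "v \<le> b"
  shows "integral {u..v} f = integral {a..v} f - integral {a..u} f"
proof -
  have "f integrable_on {a..v}"
    using assms by (auto intro: integrable_subinterval_real)
  from Henstock_Kurzweil_Integration.integral_combine[OF assms(2,3) this] show ?thesis
    by (simp add: algebra_simps)
qed

text \<open>The hard half of Hake's theorem. Choose points \<open>c n\<close> tending to \<open>b\<close> and for each \<open>n\<close> a gauge that
  makes Henstock's lemma hold on \<open>{a..c n}\<close> with error \<open>e / 2\<^sup>n\<^sup>+\<^sup>1\<close>. A tag \<open>x\<close> uses the gauge of the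
  first \<open>n\<close> with \<open>x < c n\<close>, cut off at \<open>c n\<close> so that its interval stays inside \<open>{a..c n}\<close>. Grouping the
  intervals of a fine division by this \<open>n\<close>, the errors add up to at most \<open>e\<close>.\<close>

lemma has_integral_improper_right:
  fixes f :: "real \<Rightarrow> 'a::euclidean_space"
  assumes "a < b"
    and int: "\<And>t. a < t \<Longrightarrow> t < b \<Longrightarrow> f integrable_on {a..t}"
    and lim: "((\<lambda>t. integral {a..t} f) \<longlongrightarrow> I) (at_left b)"
  shows "(f has_integral I) {a<..<b}"
proof -
  define F where "F t = (if t < b then integral {a..t} f else I)" for t
  define c where "c n = b - (b - a) / real (Suc n)" for n
  have c: "a \<le> c n" "c n < b" for n
  proof -
    have "(b - a) / real (Suc n) \<le> (b - a) / 1" "(b - a) / real (Suc n) > 0"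
      using \<open>a < b\<close> by (intro divide_left_mono divide_pos_pos; simp)+
    then show "a \<le> c n" "c n < b" by (auto simp: c_def)
  qed
  have int': "f integrable_on {a..t}" if "t < b" for t
  proof (cases "a < t")
    case False
    then have "f integrable_on cbox a t" by (intro integrable_on_null) simp
    then show ?thesis by simp
  qed (use int that in blast)
  have F: "continuous_on {a..b} F"
    unfolding continuous_on_def
  proof
    fix t assume t: "t \<in> {a..b}"
    show "(F \<longlongrightarrow> F t) (at t within {a..b})"
    proof (cases "t = b")
      case True
      have "(F \<longlongrightarrow> I) (at_left b)"
        using lim by (rule Lim_transform_eventually) (auto simp: F_def eventually_at_filter)
      moreover have "at b within {a..b} = at_left b"
        using \<open>a < b\<close> by (simp add: at_within_Icc_at_left)
      ultimately show ?thesis using True by (simp add: F_def)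
    next
      case False
      with t have "t < b" by simp
      then obtain s where s: "t < s" "s < b" using dense by blast
      have "continuous_on {a..s} (\<lambda>x. integral {a..x} f)"
        by (rule indefinite_integral_continuous_1) (use int' s in blast)
      then have "((\<lambda>x. integral {a..x} f) \<longlongrightarrow> integral {a..t} f) (at t within {a..s})"
        using t s unfolding continuous_on_def by auto
      moreover have "at t within {a..s} = at t within {a..b}"
        by (rule at_within_nhd[of _ "{..<s}"]) (use s in auto)
      ultimately have "((\<lambda>x. integral {a..x} f) \<longlongrightarrow> integral {a..t} f) (at t within {a..b})"
        by simp
      moreover have "eventually (\<lambda>x. x < b) (at t within {a..b})"
        using \<open>t < b\<close> by (metis eventually_at_topological lessThan_iff open_lessThan)
      then have "eventually (\<lambda>x. integral {a..x} f = F x) (at t within {a..b})"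
        by (rule eventually_mono) (simp add: F_def)
      ultimately have "(F \<longlongrightarrow> integral {a..t} f) (at t within {a..b})"
        by (rule Lim_transform_eventually)
      then show ?thesis
        using \<open>t < b\<close> by (simp add: F_def)
    qed
  qed
  have "(f has_integral F b - F a) {a<..<b}"
  proof (rule has_integral_Ioo_primitive[OF \<open>a < b\<close> F])
    fix e :: real assume "e > 0"
    define H where "H n \<gamma> \<longleftrightarrow> gauge \<gamma> \<and>
        (\<forall>p. p tagged_partial_division_of cbox a (c n) \<and> \<gamma> fine p \<longrightarrow>
          (\<Sum>(x,K)\<in>p. norm (measure lborel K *\<^sub>R f x - integral K f)) < e / 2 ^ Suc n)" for n \<gamma>
    have "\<exists>\<gamma>. H n \<gamma>" for n
    proof -
      have "f integrable_on cbox a (c n)" using int' c by simp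
      moreover have "e / 2 ^ Suc n > 0" using \<open>e > 0\<close> by simp
      ultimately show ?thesis unfolding H_def by (rule Henstock_lemma) blast
    qed
    then obtain \<gamma> where H: "\<And>n. H n (\<gamma> n)" by metis
    have gauge: "\<And>n. gauge (\<gamma> n)" and \<gamma>:
      "\<And>n p. p tagged_partial_division_of cbox a (c n) \<Longrightarrow> \<gamma> n fine p \<Longrightarrow>
        (\<Sum>(x,K)\<in>p. norm (measure lborel K *\<^sub>R f x - integral K f)) < e / 2 ^ Suc n"
      using H unfolding H_def by blast+
    define N where "N x = (LEAST n. x < c n)" for x
    have N: "x < c (N x)" if "x < b" for x
      unfolding N_def
    proof (rule LeastI_ex)
      obtain n where "(b - a) / (b - x) < real n"
        using reals_Archimedean2 by blast
      then have "(b - a) / (b - x) < real (Suc n)" by simp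
      then have "(b - a) / real (Suc n) < b - x"
        using that by (simp only: divide_less_eq) (simp add: mult.commute)
      then show "\<exists>n. x < c n" by (intro exI[of _ n]) (simp add: c_def)
    qed
    define \<delta> where "\<delta> x = \<gamma> (N x) x \<inter> (if x < b then {..<c (N x)} else UNIV)" for x
    have "gauge \<delta>"
      using gauge N by (auto simp: gauge_def \<delta>_def)
    have est: "(\<Sum>(x,K)\<in>P. norm (measure lborel K *\<^sub>R f x - (F (Sup K) - F (Inf K)))) \<le> e"
      if p: "p tagged_division_of {a..b}" and P: "P = {q \<in> p. fst q \<in> {a<..<b}}"
        and fine: "\<delta> fine P" for p P
    proof -
      define m where "m q = N (fst q)" for q :: "real \<times> real set"
      define Q where "Q n = {q \<in> P. m q = n}" for n
      have fin: "finite P" using P tagged_division_of_finite[OF p] by simp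
      let ?T = "\<lambda>(x,K). norm (measure lborel K *\<^sub>R f x - (F (Sup K) - F (Inf K)))"
      have Q: "sum ?T (Q n) \<le> e / 2 ^ Suc n" for n
      proof -
        have sub: "K \<subseteq> {a..c n} \<and> F (Sup K) - F (Inf K) = integral K f" if "(x, K) \<in> Q n" for x K
        proof -
          have x: "x < b" "N x = n" "(x, K) \<in> p" "(x, K) \<in> P" using that by (auto simp: Q_def P m_def)
          obtain u v where K: "u \<le> x" "x \<le> v" "a \<le> u" "v \<le> b" "Inf K = u" "Sup K = v" "K = {u..v}"
            using tagged_division_interval[OF p x(3)] by metis
          have "K \<subseteq> {..<c n}"
          proof -
            have "K \<subseteq> \<delta> x" using fine x(4) unfolding fine_def by blast
            then show ?thesis using x by (simp add: \<delta>_def)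
          qed
          then have v: "v < c n" using K by auto
          then have "v < b" using c[of n] by simp
          then have "integral {u..v} f = F v - F u"
            using integral_Icc_diff[of f a v u v] int' K by (simp add: F_def)
          with v K show ?thesis by auto
        qed
        have "Q n \<subseteq> p" by (auto simp: Q_def P)
        have "Q n tagged_partial_division_of cbox a (c n)"
          unfolding tagged_partial_division_of_def
        proof (intro conjI allI impI)
          show "finite (Q n)" using fin by (simp add: Q_def)
          fix x K assume "(x, K) \<in> Q n"
          then show "x \<in> K" "K \<subseteq> cbox a (c n)" "\<exists>a b. K = cbox a b"
            using sub tagged_division_ofD[OF p] \<open>Q n \<subseteq> p\<close> by auto
        next
          fix x1 K1 x2 K2 assume "(x1, K1) \<in> Q n \<and> (x2, K2) \<in> Q n \<and> (x1, K1) \<noteq> (x2, K2)"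
          then show "interior K1 \<inter> interior K2 = {}"
            using tagged_division_ofD(5)[OF p] \<open>Q n \<subseteq> p\<close> by blast
        qed
        moreover have "\<gamma> n fine Q n"
          using fine by (auto simp: fine_def \<delta>_def Q_def m_def)
        ultimately have "(\<Sum>(x,K)\<in>Q n. norm (measure lborel K *\<^sub>R f x - integral K f)) < e / 2 ^ Suc n"
          by (rule \<gamma>)
        moreover have "sum ?T (Q n) = (\<Sum>(x,K)\<in>Q n. norm (measure lborel K *\<^sub>R f x - integral K f))"
          using sub by (intro sum.cong) auto
        ultimately show ?thesis by simp
      qed
      have sums: "(\<lambda>n. e / 2 ^ Suc n) sums e"
        using sums_mult[OF power_half_series, of e] by (simp add: power_divide)
      have "sum ?T P = (\<Sum>n\<in>m ` P. sum ?T (Q n))"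
        unfolding Q_def by (rule sum.image_gen[OF fin])
      also have "\<dots> \<le> (\<Sum>n\<in>m ` P. e / 2 ^ Suc n)"
        by (intro sum_mono Q)
      also have "\<dots> \<le> (\<Sum>n. e / 2 ^ Suc n)"
      proof (rule sum_le_suminf)
        show "summable (\<lambda>n. e / 2 ^ Suc n)" using sums by (rule sums_summable)
        show "finite (m ` P)" using fin by simp
        show "e / 2 ^ Suc n \<ge> 0" for n using \<open>e > 0\<close> by simp
      qed
      also have "\<dots> = e"
        using sums by (rule sums_unique[symmetric])
      finally show ?thesis .
    qed
    show "\<exists>\<gamma>. gauge \<gamma> \<and> (\<forall>p. p tagged_division_of {a..b} \<longrightarrow> 
       \<gamma> fine {q \<in> p. fst q \<in> {a<..<b}} \<longrightarrow>
       (\<Sum>(x,K) \<in> {q \<in> p. fst q \<in> {a<..<b}}. norm (measure lborel K *\<^sub>R f x - (F (Sup K) - F (Inf K)))) \<le> e)"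
    proof (intro exI[of _ \<delta>] conjI allI impI)
      show "gauge \<delta>" by fact
    qed (rule est[OF _ refl])
  qed
  moreover have "F b - F a = I" using \<open>a < b\<close> by (simp add: F_def)
  ultimately show ?thesis by simp
qed

lemma has_integral_Ioo_iff_improper:
  fixes f :: "real \<Rightarrow> 'a::euclidean_space"
  assumes "a < b"
  shows "(f has_integral I) {a<..<b} \<longleftrightarrow>
    (\<forall>t. a < t \<and> t < b \<longrightarrow> f integrable_on {a..t}) \<and> ((\<lambda>t. integral {a..t} f) \<longlongrightarrow> I) (at_left b)"
proof (intro iffI conjI allI impI)
  assume "(f has_integral I) {a<..<b}"
  then have I: "(f has_integral I) {a..b}" by (simp add: has_integral_Icc_iff_Ioo)
  have f: "f integrable_on {a..b}" using I by (rule has_integral_integrable)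
  show "f integrable_on {a..t}" if "a < t \<and> t < b" for t
    by (rule integrable_subinterval_real[OF f]) (use that in auto)
  have "continuous_on {a..b} (\<lambda>t. integral {a..t} f)"
    using f by (rule indefinite_integral_continuous_1)
  then have "((\<lambda>t. integral {a..t} f) \<longlongrightarrow> integral {a..b} f) (at b within {a..b})"
    using assms unfolding continuous_on_def by auto
  then show "((\<lambda>t. integral {a..t} f) \<longlongrightarrow> I) (at_left b)"
    using I assms by (simp add: at_within_Icc_at_left integral_unique)
next
  assume *: "(\<forall>t. a < t \<and> t < b \<longrightarrow> f integrable_on {a..t}) \<and> ((\<lambda>t. integral {a..t} f) \<longlongrightarrow> I) (at_left b)"
  show "(f has_integral I) {a<..<b}"
    by (rule has_integral_improper_right[OF assms]) (use * in auto)
qed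

text \<open>The integral over an unbounded set is defined by a limit over large boxes, and a large box
  meets \<open>{a..}\<close> in an interval starting at \<open>a\<close>.\<close>

lemma has_integral_Ioi_iff_improper:
  fixes f :: "real \<Rightarrow> 'a::euclidean_space"
  shows "(f has_integral I) {a<..} \<longleftrightarrow>
    (\<forall>t>a. f integrable_on {a..t}) \<and> ((\<lambda>t. integral {a..t} f) \<longlongrightarrow> I) at_top"
proof -
  have int: "{a..} \<inter> {m..n} = {max a m..n}" for m n :: real by auto
  have "(f has_integral I) {a<..} \<longleftrightarrow> (f has_integral I) {a..}"
  proof (rule has_integral_spike_set_eq)
    show "negligible {x \<in> {a<..} - {a..}. f x \<noteq> 0}"
      by (rule negligible_subset[of "{}"]) auto
    show "negligible {x \<in> {a..} - {a<..}. f x \<noteq> 0}"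
      by (rule negligible_subset[of "{a}"]) auto
  qed
  also have "\<dots> \<longleftrightarrow> (\<forall>m n. f integrable_on {max a m..n}) \<and>
      (\<forall>e>0. \<exists>B>0. \<forall>m n. ball 0 B \<subseteq> {m..n} \<longrightarrow> norm (integral {max a m..n} f - I) < e)"
    unfolding has_integral_alt' integrable_restrict_Int
      Henstock_Kurzweil_Integration.integral_restrict_Int cbox_interval int ..
  also have "\<dots> \<longleftrightarrow> (\<forall>t>a. f integrable_on {a..t}) \<and> ((\<lambda>t. integral {a..t} f) \<longlongrightarrow> I) at_top"
    (is "?L1 \<and> ?L2 \<longleftrightarrow> ?R1 \<and> ?R2")
  proof -
    have "?L1 \<longleftrightarrow> ?R1"
    proof (intro iffI allI impI)
      fix t assume ?L1 then have "f integrable_on {max a a..t}" by blast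
      then show "f integrable_on {a..t}" by simp
    next
      fix m n assume R: ?R1
      show "f integrable_on {max a m..n}"
      proof (cases "a < n")
        case True
        then have "f integrable_on {a..n}" using R by blast
        then show ?thesis by (rule integrable_subinterval_real) auto
      next
        case False
        then have "f integrable_on cbox (max a m) n" by (intro integrable_on_null) simp
        then show ?thesis by simp
      qed
    qed
    moreover have "?L2 \<longleftrightarrow> ?R2"
    proof
      assume L: ?L2
      show ?R2
      proof (rule tendstoI)
        fix e :: real assume "e > 0"
        then obtain B where B: "B > 0" 
          "\<And>m n. ball 0 B \<subseteq> {m..n} \<Longrightarrow> norm (integral {max a m..n} f - I) < e"
          using L by blast
        have "dist (integral {a..t} f) I < e" if "t \<ge> B" for t
        proof -
          have "ball 0 B \<subseteq> {min a (-B)..t}" using that by (auto simp: ball_def)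
          from B(2)[OF this] show ?thesis by (simp add: dist_norm)
        qed
        then show "\<forall>\<^sub>F t in at_top. dist (integral {a..t} f) I < e"
          by (auto simp: eventually_at_top_linorder)
      qed
    next
      assume R: ?R2
      show ?L2
      proof (intro allI impI)
        fix e :: real assume "e > 0"
        then obtain B where B: "\<And>t. t \<ge> B \<Longrightarrow> dist (integral {a..t} f) I < e"
          using tendstoD[OF R] by (auto simp: eventually_at_top_linorder)
        \<comment> \<open>Large enough that a box around the ball contains \<open>a\<close> and reaches beyond \<open>B\<close>.\<close>
        define C where "C = max (max B 1) (\<bar>a\<bar> + 1)"
        have "norm (integral {max a m..n} f - I) < e" if sub: "ball 0 C \<subseteq> {m..n}" for m n
        proof -
          have "a \<in> ball 0 C" by (auto simp: C_def)
          then have "max a m = a" using sub by auto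
          moreover have "{-C<..<C} \<subseteq> {m..n}" using sub by (auto simp: ball_def subset_iff abs_less_iff)
          then have "C \<le> n" by (subst (asm) greaterThanLessThan_subseteq_atLeastAtMost_iff) (auto simp: C_def)
          then have "B \<le> n" by (simp add: C_def)
          ultimately show ?thesis using B by (simp add: dist_norm)
        qed
        moreover have "C > 0" by (simp add: C_def)
        ultimately show "\<exists>B>0. \<forall>m n. ball 0 B \<subseteq> {m..n} \<longrightarrow> norm (integral {max a m..n} f - I) < e"
          by blast
      qed
    qed
    ultimately show ?thesis by blast
  qed
  finally show ?thesis .
qed

section \<open>Change of variables for arbitrary integrands\<close>

text \<open>With \<open>F\<close> the indefinite integral of \<open>f\<close>, the map \<open>F \<circ> h\<close> satisfies the criterion
  \<open>has_integral_Ioo_primitive\<close> for \<open>h' (f \<circ> h)\<close>. For an interval \<open>{u..v}\<close> with tag \<open>s\<close> the deviation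
  splits into the Henstock term of \<open>f\<close> on \<open>{h u..h v}\<close> with tag \<open>h s\<close>, and
  \<open>\<bar>h v - h u - h' s (v - u)\<bar> \<bar>f (h s)\<bar>\<close>, which differentiability at \<open>s\<close> bounds by a small multiple
  of \<open>v - u\<close>. The gauge at \<open>s\<close> may depend on the size of \<open>f (h s)\<close>, which is what makes this multiple
  small.\<close>

lemma has_integral_substitution_increasing:
  fixes f :: "real \<Rightarrow> 'a::euclidean_space" and h h' :: "real \<Rightarrow> real"
  assumes "c < d" and cont: "continuous_on {c..d} h" and mono: "strict_mono_on {c..d} h"
    and der: "\<And>s. c < s \<Longrightarrow> s < d \<Longrightarrow> (h has_real_derivative h' s) (at s)"
    and f: "(f has_integral I) {h c<..<h d}"
  shows "((\<lambda>s. h' s *\<^sub>R f (h s)) has_integral I) {c<..<d}"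
proof -
  have less: "h u < h v \<longleftrightarrow> u < v" and le: "h u \<le> h v \<longleftrightarrow> u \<le> v"
    if "u \<in> {c..d}" "v \<in> {c..d}" for u v
    using strict_mono_on_less[OF mono that] strict_mono_on_less_eq[OF mono that] by auto
  have fI: "(f has_integral I) {h c..h d}"
    using f by (simp add: has_integral_Icc_iff_Ioo)
  then have int: "f integrable_on {h c..h d}"
    by (rule has_integral_integrable)
  define F where "F t = integral {h c..t} f" for t
  have h_in: "h s \<in> {h c..h d}" if "s \<in> {c..d}" for s
    using le[of c s] le[of s d] that by auto
  have "continuous_on {h c..h d} F"
    unfolding F_def using int by (rule indefinite_integral_continuous_1)
  then have contF: "continuous_on {c..d} (\<lambda>s. F (h s))"
    by (rule continuous_on_compose2[OF _ cont]) (use h_in in blast)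
  have "((\<lambda>s. h' s *\<^sub>R f (h s)) has_integral F (h d) - F (h c)) {c<..<d}"
  proof (rule has_integral_Ioo_primitive[OF \<open>c < d\<close> contF])
    fix e :: real assume "e > 0"
    define \<eta> where "\<eta> = e / (2 * (d - c))"
    have "\<eta> > 0" using \<open>e > 0\<close> \<open>c < d\<close> by (simp add: \<eta>_def)
    have "f integrable_on cbox (h c) (h d)" "e / 2 > 0"
      using int \<open>e > 0\<close> by simp_all
    then obtain \<gamma> where "gauge \<gamma>" and \<gamma>: "\<And>p. p tagged_partial_division_of cbox (h c) (h d) \<Longrightarrow>
        \<gamma> fine p \<Longrightarrow> (\<Sum>(x,K)\<in>p. norm (measure lborel K *\<^sub>R f x - integral K f)) < e / 2"
      by (rule Henstock_lemma) blast
    define D where "D s \<delta> \<longleftrightarrow> \<delta> > 0 \<and> (\<forall>r\<in>{c..d}. \<bar>r - s\<bar> < \<delta> \<longrightarrow> h r \<in> \<gamma> (h s) \<and>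
        \<bar>h r - h s - h' s * (r - s)\<bar> * norm (f (h s)) \<le> \<eta> * \<bar>r - s\<bar>)" for s \<delta>
    have "\<exists>\<delta>. D s \<delta>" if s: "c < s" "s < d" for s
    proof -
      have "open (\<gamma> (h s))" "h s \<in> \<gamma> (h s)"
        using \<open>gauge \<gamma>\<close> by (auto simp: gauge_def)
      then obtain \<epsilon> where \<epsilon>: "\<epsilon> > 0" "ball (h s) \<epsilon> \<subseteq> \<gamma> (h s)"
        by (meson openE)
      have "s \<in> {c..d}" using s by simp
      then obtain \<delta>1 where \<delta>1: "\<delta>1 > 0" "\<And>r. r \<in> {c..d} \<Longrightarrow> dist r s < \<delta>1 \<Longrightarrow> dist (h r) (h s) < \<epsilon>"
        using cont \<epsilon>(1) unfolding continuous_on_iff by blast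
      \<comment> \<open>Adding \<open>1\<close> keeps the divisor below positive when \<open>f (h s) = 0\<close>.\<close>
      define N where "N = norm (f (h s)) + 1"
      have N: "N > 0" "norm (f (h s)) \<le> N" by (auto simp: N_def add_nonneg_pos)
      then have "\<eta> / N > 0" using \<open>\<eta> > 0\<close> by simp
      moreover have "(h has_derivative (\<lambda>x. h' s * x)) (at s)"
        using der[OF s] by (simp add: has_field_derivative_def)
      ultimately obtain \<delta>2 where \<delta>2: "\<delta>2 > 0" "\<And>r. \<bar>r - s\<bar> < \<delta>2 \<Longrightarrow>
          \<bar>h r - h s - h' s * (r - s)\<bar> \<le> \<eta> / N * \<bar>r - s\<bar>"
        unfolding has_derivative_at_alt real_norm_def by blast
      have "h r \<in> \<gamma> (h s) \<and> \<bar>h r - h s - h' s * (r - s)\<bar> * norm (f (h s)) \<le> \<eta> * \<bar>r - s\<bar>"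
        if r: "r \<in> {c..d}" "\<bar>r - s\<bar> < min \<delta>1 \<delta>2" for r
      proof
        have "dist (h r) (h s) < \<epsilon>"
          using \<delta>1(2)[of r] r by (simp add: dist_real_def)
        then show "h r \<in> \<gamma> (h s)"
          using \<epsilon>(2) by (auto simp: dist_commute)
        have "\<bar>h r - h s - h' s * (r - s)\<bar> * norm (f (h s)) \<le> (\<eta> / N * \<bar>r - s\<bar>) * N"
          using \<delta>2(2)[of r] r N by (intro mult_mono) auto
        then show "\<bar>h r - h s - h' s * (r - s)\<bar> * norm (f (h s)) \<le> \<eta> * \<bar>r - s\<bar>"
          using N by simp
      qed
      moreover have "min \<delta>1 \<delta>2 > 0" using \<delta>1 \<delta>2 by simp
      ultimately show ?thesis unfolding D_def by blast
    qed
    then obtain \<delta> where D: "\<And>s. c < s \<Longrightarrow> s < d \<Longrightarrow> D s (\<delta> s)"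
      by metis
    have \<delta>: "\<And>s. c < s \<Longrightarrow> s < d \<Longrightarrow> \<delta> s > 0"
      "\<And>s r. c < s \<Longrightarrow> s < d \<Longrightarrow> r \<in> {c..d} \<Longrightarrow> \<bar>r - s\<bar> < \<delta> s \<Longrightarrow> h r \<in> \<gamma> (h s)"
      "\<And>s r. c < s \<Longrightarrow> s < d \<Longrightarrow> r \<in> {c..d} \<Longrightarrow> \<bar>r - s\<bar> < \<delta> s \<Longrightarrow>
        \<bar>h r - h s - h' s * (r - s)\<bar> * norm (f (h s)) \<le> \<eta> * \<bar>r - s\<bar>"
      using D unfolding D_def by blast+
    define \<Gamma> where "\<Gamma> s = (if c < s \<and> s < d then ball s (\<delta> s) else UNIV)" for s
    have "gauge \<Gamma>"
      using \<delta>(1) by (auto simp: gauge_def \<Gamma>_def)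
    have est: "(\<Sum>(s,K)\<in>P. norm (measure lborel K *\<^sub>R h' s *\<^sub>R f (h s) - (F (h (Sup K)) - F (h (Inf K))))) \<le> e"
      if p: "p tagged_division_of {c..d}" and P: "P = {q \<in> p. fst q \<in> {c<..<d}}"
        and fine: "\<Gamma> fine P" for p P
    proof -
      \<comment> \<open>The image under \<open>h\<close> of the tagged division, written with endpoints so that it visibly
        consists of intervals.\<close>
      define L where "L K = {h (Inf K)..h (Sup K)}" for K :: "real set"
      define \<phi> where "\<phi> = (\<lambda>(s :: real, K :: real set). (h s, L K))"
      let ?T = "\<lambda>(x,K). norm (measure lborel K *\<^sub>R f x - integral K f)"
      have fin: "finite P" using P tagged_division_of_finite[OF p] by simp
      have PD: "\<exists>u v. K = {u..v} \<and> u \<le> s \<and> s \<le> v \<and> c \<le> u \<and> v \<le> d \<and> Inf K = u \<and> Sup K = v \<and>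
          measure lborel K = v - u \<and> L K = {h u..h v} \<and> c < s \<and> s < d \<and> K \<subseteq> ball s (\<delta> s)"
        if "(s, K) \<in> P" for s K
      proof -
        have "(s, K) \<in> p" and s: "c < s" "s < d" using that by (auto simp: P)
        moreover have "K \<subseteq> \<Gamma> s" using fine that unfolding fine_def by blast
        then have "K \<subseteq> ball s (\<delta> s)" using s by (simp add: \<Gamma>_def)
        ultimately show ?thesis
          using tagged_division_interval[OF p, of s K] unfolding L_def by metis
      qed
      have inj: "inj_on \<phi> P"
      proof (rule inj_onI)
        fix q r assume q: "q \<in> P" and r: "r \<in> P" and eq: "\<phi> q = \<phi> r"
        obtain s K where sK: "q = (s, K)" by (cases q)
        obtain s' K' where sK': "r = (s', K')" by (cases r)
        obtain u v where 1: "K = {u..v}" "u \<le> s" "s \<le> v" "c \<le> u" "v \<le> d" "L K = {h u..h v}"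
          using PD q sK by blast
        obtain u' v' where 2: "K' = {u'..v'}" "u' \<le> s'" "s' \<le> v'" "c \<le> u'" "v' \<le> d" "L K' = {h u'..h v'}"
          using PD r sK' by blast
        have "h u \<le> h v" using le[of u v] 1 by simp
        moreover have "h s = h s'" "{h u..h v} = {h u'..h v'}"
          using eq sK sK' 1 2 by (auto simp: \<phi>_def)
        ultimately have "h s = h s'" "h u = h u'" "h v = h v'"
          by (auto simp: Icc_eq_Icc)
        moreover have "inj_on h {c..d}" using mono by (rule strict_mono_on_imp_inj_on)
        ultimately have "s = s'" "u = u'" "v = v'"
          using 1 2 by (auto elim!: inj_onD)
        then show "q = r" using sK sK' 1 2 by simp
      qed
      have part: "\<phi> ` P tagged_partial_division_of cbox (h c) (h d)"
        unfolding tagged_partial_division_of_def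
      proof (intro conjI allI impI)
        show "finite (\<phi> ` P)" using fin by simp
        fix x J assume "(x, J) \<in> \<phi> ` P"
        then obtain s K where sK: "(s, K) \<in> P" "x = h s" "J = L K"
          by (auto simp: \<phi>_def)
        then obtain u v where 1: "u \<le> s" "s \<le> v" "c \<le> u" "v \<le> d" "L K = {h u..h v}"
          using PD by blast
        show "x \<in> J" using sK 1 le[of u s] le[of s v] by simp
        show "J \<subseteq> cbox (h c) (h d)"
          using sK 1 le[of c u] le[of v d] by auto
        show "\<exists>a b. J = cbox a b"
          using sK 1 by (metis cbox_interval)
      next
        fix x1 J1 x2 J2 assume *: "(x1, J1) \<in> \<phi> ` P \<and> (x2, J2) \<in> \<phi> ` P \<and> (x1, J1) \<noteq> (x2, J2)"
        then obtain s1 K1 s2 K2 where sK: "(s1, K1) \<in> P" "J1 = L K1" "(s2, K2) \<in> P" "J2 = L K2"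
          "(s1, K1) \<noteq> (s2, K2)"
          by (auto simp: \<phi>_def)
        have "interior K1 \<inter> interior K2 = {}"
        proof -
          have "(s1, K1) \<in> p" "(s2, K2) \<in> p" using sK by (simp_all add: P)
          then show ?thesis using tagged_division_ofD(5)[OF p] sK(5) by blast
        qed
        moreover obtain u1 v1 where 1: "K1 = {u1..v1}" "u1 \<le> v1" "c \<le> u1" "v1 \<le> d" "L K1 = {h u1..h v1}"
          using PD[OF sK(1)] by force
        moreover obtain u2 v2 where 2: "K2 = {u2..v2}" "u2 \<le> v2" "c \<le> u2" "v2 \<le> d" "L K2 = {h u2..h v2}"
          using PD[OF sK(3)] by force
        ultimately have dis: "{u1<..<v1} \<inter> {u2<..<v2} = {}"
          by (simp add: interior_atLeastAtMost_real)
        have "{h u1<..<h v1} \<inter> {h u2<..<h v2} = {}"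
        proof (rule equals0I)
          fix y assume "y \<in> {h u1<..<h v1} \<inter> {h u2<..<h v2}"
          then have "h u1 < h v1" "h u1 < h v2" "h u2 < h v1" "h u2 < h v2" by auto
          then have "u1 < v1" "u1 < v2" "u2 < v1" "u2 < v2"
            using less 1 2 by auto
          then have "max u1 u2 < min v1 v2" by simp
          then obtain z where "max u1 u2 < z" "z < min v1 v2" using dense by blast
          then have "z \<in> {u1<..<v1} \<inter> {u2<..<v2}" by simp
          with dis show False by blast
        qed
        then show "interior J1 \<inter> interior J2 = {}"
          using sK 1 2 by (simp only: interior_atLeastAtMost_real)
      qed
      have fine': "\<gamma> fine \<phi> ` P"
      proof (rule fineI)
        fix x J assume "(x, J) \<in> \<phi> ` P"
        then obtain s K where sK: "(s, K) \<in> P" "x = h s" "J = L K"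
          by (auto simp: \<phi>_def)
        then obtain u v where 1: "K = {u..v}" "u \<le> s" "s \<le> v" "c \<le> u" "v \<le> d" "L K = {h u..h v}"
          "c < s" "s < d" "K \<subseteq> ball s (\<delta> s)"
          using PD by blast
        have "continuous_on {u..v} h"
          using cont by (rule continuous_on_subset) (use 1 in auto)
        show "J \<subseteq> \<gamma> x"
        proof
          fix y assume y: "y \<in> J"
          obtain r where r: "u \<le> r" "r \<le> v" "h r = y"
            using \<open>continuous_on {u..v} h\<close> IVT'[of h u y v] y sK 1 by auto
          then have "r \<in> ball s (\<delta> s)" using 1 by auto
          then have "\<bar>r - s\<bar> < \<delta> s" by (simp add: dist_real_def abs_minus_commute)
          then show "y \<in> \<gamma> x"
            using \<delta>(2)[of s r] 1 r sK by auto
        qed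
      qed
      have "(\<Sum>(s,K)\<in>P. norm (measure lborel K *\<^sub>R h' s *\<^sub>R f (h s) - (F (h (Sup K)) - F (h (Inf K)))))
          \<le> (\<Sum>(s,K)\<in>P. ?T (\<phi> (s, K)) + \<eta> * measure lborel K)"
      proof (rule sum_mono, clarify)
        fix s K assume "(s, K) \<in> P"
        then obtain u v where 1: "K = {u..v}" "u \<le> s" "s \<le> v" "c \<le> u" "v \<le> d" "Inf K = u" "Sup K = v"
          "measure lborel K = v - u" "L K = {h u..h v}" "c < s" "s < d" "K \<subseteq> ball s (\<delta> s)"
          using PD by blast
        define E where "E r = h r - h s - h' s * (r - s)" for r
        have E: "\<bar>E r\<bar> * norm (f (h s)) \<le> \<eta> * \<bar>r - s\<bar>" if "r \<in> {u, v}" for r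
        proof -
          have "r \<in> K" using that 1(1-3) by auto
          then have "r \<in> ball s (\<delta> s)" using 1 by blast
          then show ?thesis unfolding E_def
            by (intro \<delta>(3)) (use 1 that in \<open>auto simp: dist_real_def\<close>)
        qed
        have huv: "h u \<le> h v" using le[of u v] 1 by simp
        have F: "F (h v) - F (h u) = integral {h u..h v} f"
          unfolding F_def by (rule integral_Icc_diff[OF int, symmetric]) (use 1 huv le[of c u] le[of v d] in auto)
        have "(v - u) *\<^sub>R h' s *\<^sub>R f (h s) - (F (h v) - F (h u)) =
            ((h v - h u) *\<^sub>R f (h s) - integral {h u..h v} f) - (E v - E u) *\<^sub>R f (h s)"
          unfolding F E_def by (simp add: algebra_simps)
        also have "norm \<dots> \<le> norm ((h v - h u) *\<^sub>R f (h s) - integral {h u..h v} f) + \<bar>E v - E u\<bar> * norm (f (h s))"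
          by (rule order_trans[OF norm_triangle_ineq4]) simp
        also have "\<bar>E v - E u\<bar> * norm (f (h s)) \<le> \<bar>E v\<bar> * norm (f (h s)) + \<bar>E u\<bar> * norm (f (h s))"
          unfolding distrib_right[symmetric] by (rule mult_right_mono) auto
        also have "\<dots> \<le> \<eta> * \<bar>v - s\<bar> + \<eta> * \<bar>u - s\<bar>"
          by (intro add_mono E) auto
        also have "\<dots> = \<eta> * (v - u)"
          using 1 by (simp add: algebra_simps)
        finally show "norm (measure lborel K *\<^sub>R h' s *\<^sub>R f (h s) - (F (h (Sup K)) - F (h (Inf K))))
            \<le> ?T (\<phi> (s, K)) + \<eta> * measure lborel K"
          using 1 huv by (simp add: \<phi>_def)
      qed
      also have "\<dots> = (\<Sum>q\<in>P. ?T (\<phi> q)) + \<eta> * (\<Sum>(s,K)\<in>P. measure lborel K)"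
        by (simp add: sum.distrib sum_distrib_left case_prod_unfold)
      also have "(\<Sum>q\<in>P. ?T (\<phi> q)) = sum ?T (\<phi> ` P)"
        by (simp add: sum.reindex[OF inj])
      also have "sum ?T (\<phi> ` P) \<le> e / 2"
        using \<gamma>[OF part fine'] by simp
      also have "(\<Sum>(s,K)\<in>P. measure lborel K) \<le> (\<Sum>(s,K)\<in>p. measure lborel K)"
        by (rule sum_mono2) (use tagged_division_of_finite[OF p] in \<open>auto simp: P\<close>)
      also have "\<dots> = d - c"
        using additive_content_tagged_division[of p c d] p \<open>c < d\<close> by simp
      also have "e / 2 + \<eta> * (d - c) = e"
      proof -
        have "d - c \<noteq> 0" using \<open>c < d\<close> by simp
        then have "\<eta> * (d - c) = e / 2" unfolding \<eta>_def by (simp add: divide_simps)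
        then show ?thesis by simp
      qed
      finally show ?thesis using \<open>\<eta> > 0\<close> by simp
    qed
    show "\<exists>\<gamma>. gauge \<gamma> \<and> (\<forall>p. p tagged_division_of {c..d} \<longrightarrow> 
       \<gamma> fine {q \<in> p. fst q \<in> {c<..<d}} \<longrightarrow>
       (\<Sum>(s,K) \<in> {q \<in> p. fst q \<in> {c<..<d}}.
          norm (measure lborel K *\<^sub>R h' s *\<^sub>R f (h s) - (F (h (Sup K)) - F (h (Inf K))))) \<le> e)"
    proof (intro exI[of _ \<Gamma>] conjI allI impI)
      show "gauge \<Gamma>" by fact
    qed (rule est[OF _ refl])
  qed
  moreover have "F (h d) - F (h c) = I"
    using fI by (simp add: F_def integral_unique)
  ultimately show ?thesis by simp
qed

text \<open>For the converse, substitute with the inverse function: \<open>h' > 0\<close> makes it differentiable, and the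
  two derivative factors cancel.\<close>

lemma has_integral_substitution_increasing_iff:
  fixes f :: "real \<Rightarrow> 'a::euclidean_space" and h h' :: "real \<Rightarrow> real"
  assumes "c < d" and cont: "continuous_on {c..d} h"
    and der: "\<And>s. c < s \<Longrightarrow> s < d \<Longrightarrow> (h has_real_derivative h' s) (at s)"
    and pos: "\<And>s. c < s \<Longrightarrow> s < d \<Longrightarrow> h' s > 0"
  shows "(f has_integral I) {h c<..<h d} \<longleftrightarrow> ((\<lambda>s. h' s *\<^sub>R f (h s)) has_integral I) {c<..<d}"
proof
  have mono: "strict_mono_on {c..d} h"
  proof (rule strict_mono_onI)
    fix r s assume rs: "r \<in> {c..d}" "s \<in> {c..d}" "r < s"
    show "h r < h s"
    proof (rule DERIV_pos_imp_increasing_open[OF \<open>r < s\<close>])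
      show "\<exists>y. DERIV h x :> y \<and> y > 0" if "r < x" "x < s" for x
        using der[of x] pos[of x] that rs by auto
      show "continuous_on {r..s} h"
        using cont by (rule continuous_on_subset) (use rs in auto)
    qed
  qed
  show "((\<lambda>s. h' s *\<^sub>R f (h s)) has_integral I) {c<..<d}" if "(f has_integral I) {h c<..<h d}"
    using assms(1) cont mono der that by (rule has_integral_substitution_increasing)
  assume g: "((\<lambda>s. h' s *\<^sub>R f (h s)) has_integral I) {c<..<d}"
  define k where "k = the_inv_into {c..d} h"
  have inj: "inj_on h {c..d}" using mono by (rule strict_mono_on_imp_inj_on)
  have kh: "k (h s) = s" if "s \<in> {c..d}" for s
    unfolding k_def using the_inv_into_f_f[OF inj that] .
  have less: "h u < h v \<longleftrightarrow> u < v" if "u \<in> {c..d}" "v \<in> {c..d}" for u v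
    using strict_mono_on_less[OF mono that] .
  have "h c < h d" using less[of c d] \<open>c < d\<close> by simp
  have img: "\<exists>s\<in>{c..d}. t = h s" if "t \<in> {h c..h d}" for t
    using IVT'[of h c t d] that cont \<open>c < d\<close> by force
  have hk: "h (k t) = t" "k t \<in> {c..d}" if "t \<in> {h c..h d}" for t
    using img[OF that] kh by auto
  have k_in: "c < k t \<and> k t < d" if "h c < t" "t < h d" for t
    using hk[of t] less[of c "k t"] less[of "k t" d] that \<open>c < d\<close> by auto
  have "h ` {c..d} = {h c..h d}"
    using img strict_mono_on_less_eq[OF mono] \<open>c < d\<close> by fastforce
  then have contk: "continuous_on {h c..h d} k"
    using continuous_on_inv[OF cont compact_Icc] kh by auto
  have monok: "strict_mono_on {h c..h d} k"
    by (rule strict_mono_onI) (metis hk less)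
  have derk: "(k has_real_derivative inverse (h' (k t))) (at t)" if "h c < t" "t < h d" for t
  proof (rule DERIV_inverse_function[where f = h and g = k and x = t and a = "h c" and b = "h d"])
    show "DERIV h (k t) :> h' (k t)" using der k_in[OF that] by blast
    show "h' (k t) \<noteq> 0" using pos k_in[OF that] by force
    show "h (k y) = y" if "h c < y" "y < h d" for y using hk[of y] that by simp
    show "isCont k t"
      using continuous_on_interior[OF contk] that by (simp add: interior_atLeastAtMost_real)
  qed (use that in auto)
  have ends: "k (h c) = c" "k (h d) = d" using kh \<open>c < d\<close> by auto
  have "((\<lambda>t. inverse (h' (k t)) *\<^sub>R h' (k t) *\<^sub>R f (h (k t))) has_integral I) {h c<..<h d}"
    using has_integral_substitution_increasing[OF \<open>h c < h d\<close> contk monok derk] g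
    unfolding ends by blast
  then show "(f has_integral I) {h c<..<h d}"
  proof (rule has_integral_eq[rotated])
    fix t assume t: "t \<in> {h c<..<h d}"
    then have "h' (k t) > 0" "h (k t) = t"
      using pos k_in[of t] hk[of t] by auto
    then show "inverse (h' (k t)) *\<^sub>R h' (k t) *\<^sub>R f (h (k t)) = f t" by simp
  qed
qed

section \<open>The two substitutions for the \<open>\<Psi>\<close>-beta function\<close>

text \<open>Equality of the values also covers the divergent case, where both take the default value \<open>0\<close>.\<close>

lemma integrable_integral_eq_of_has_integral_iff:
  fixes f :: "'n::euclidean_space \<Rightarrow> 'a::banach" and g :: "'m::euclidean_space \<Rightarrow> 'a"
  assumes "\<And>I. (f has_integral I) S \<longleftrightarrow> (g has_integral I) T"
  shows "f integrable_on S \<longleftrightarrow> g integrable_on T" and "integral S f = integral T g"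
proof -
  show *: "f integrable_on S \<longleftrightarrow> g integrable_on T"
    using assms by (simp add: integrable_on_def)
  show "integral S f = integral T g"
  proof (cases "f integrable_on S")
    case True
    then have "(g has_integral integral S f) T" using assms by blast
    then show ?thesis by (simp add: integral_unique)
  next
    case False
    with * show ?thesis by (simp add: not_integrable_integral)
  qed
qed

text \<open>The argument \<open>1 - sin\<^sup>2 \<theta>\<close>, rather than \<open>cos\<^sup>2 \<theta>\<close>, is the form that arises from reflecting the beta
  integrand and then substituting \<open>sin\<^sup>2 \<theta>\<close>.\<close>

lemma trig_integrand_eq:
  assumes "0 < \<theta>" "\<theta> < pi / 2"
  shows "2 * Psi_beta_trig_integrand p \<alpha> \<beta> x y \<theta> =
    (2 * sin \<theta> * cos \<theta>) *\<^sub>R Psi_beta_integrand p \<alpha> \<beta> x y (1 - (sin \<theta>)\<^sup>2)"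
proof -
  have pos: "cos \<theta> > 0" "sin \<theta> > 0"
    using assms by (auto intro!: cos_gt_zero sin_gt_zero2)
  have pw: "of_real (r\<^sup>2) powr (z - 1) * of_real r = (of_real r :: complex) powr (2 * z - 1)"
    if "r > 0" for r z
  proof -
    have "of_real (r\<^sup>2) powr (z - 1) = (of_real r :: complex) powr (2 * (z - 1))"
    proof -
      have "Ln (of_real (r\<^sup>2)) = 2 * of_real (ln r)"
        using Ln_of_real[of "r\<^sup>2"] that by (simp add: ln_realpow del: of_real_power)
      then show ?thesis
        using that by (simp add: powr_def Ln_of_real algebra_simps del: of_real_power)
    qed
    then have "of_real (r\<^sup>2) powr (z - 1) * of_real r
        = (of_real r :: complex) powr (2 * (z - 1) + 1)"
      using that by (subst powr_add) simp
    then show ?thesis by (simp add: algebra_simps)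
  qed
  have arg: "- p / of_real ((cos \<theta>)\<^sup>2 * (sin \<theta>)\<^sup>2) = - p * of_real ((1 / cos \<theta>)\<^sup>2 * (1 / sin \<theta>)\<^sup>2)"
    by (simp add: power_divide)
  have "1 - (sin \<theta>)\<^sup>2 = (cos \<theta>)\<^sup>2" "1 - (cos \<theta>)\<^sup>2 = (sin \<theta>)\<^sup>2"
    by (simp_all add: sin_squared_eq)
  then have "(2 * sin \<theta> * cos \<theta>) *\<^sub>R Psi_beta_integrand p \<alpha> \<beta> x y (1 - (sin \<theta>)\<^sup>2) =
      2 * ((of_real ((cos \<theta>)\<^sup>2) powr (x - 1) * of_real (cos \<theta>)) *
        (of_real ((sin \<theta>)\<^sup>2) powr (y - 1) * of_real (sin \<theta>)) *
        wright_psi \<alpha> \<beta> (- p / of_real ((cos \<theta>)\<^sup>2 * (sin \<theta>)\<^sup>2)))"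
    unfolding Psi_beta_integrand_def scaleR_conv_of_real by (simp only:) (simp add: mult_ac)
  also have "\<dots> = 2 * Psi_beta_trig_integrand p \<alpha> \<beta> x y \<theta>"
    unfolding pw[OF pos(1)] pw[OF pos(2)] arg Psi_beta_trig_integrand_def ..
  finally show ?thesis ..
qed

lemma halfline_integrand_eq:
  assumes "u > 0"
  shows "Psi_beta_halfline_integrand p \<alpha> \<beta> x y u =
    (1 / (1 + u)\<^sup>2) *\<^sub>R Psi_beta_integrand p \<alpha> \<beta> x y (u / (1 + u))"
proof -
  have [simp]: "1 + complex_of_real u \<noteq> 0"
    using assms by (metis add_pos_pos less_irrefl of_real_1 of_real_add of_real_eq_0_iff zero_less_one)
  have pw: "of_real (a / b) powr z = (of_real a :: complex) powr z / of_real b powr z"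
    if "a > 0" "b > 0" for a b z
    using that by (simp add: powr_def Ln_of_real ln_div exp_diff algebra_simps flip: of_real_divide)
  have one: "of_real 1 powr z = (1 :: complex)" for z by simp
  have compl: "1 - u / (1 + u) = 1 / (1 + u)"
    using assms by (simp add: field_simps)
  have arg: "- p / of_real (u / (1 + u) * (1 / (1 + u))) = - 2 * p - p * of_real (u + 1 / u)"
    using assms by (simp add: field_simps power2_eq_square)
  have weight: "of_real (u / (1 + u)) powr (x - 1) * of_real (1 / (1 + u)) powr (y - 1) * of_real (1 / (1 + u)\<^sup>2) =
      of_real u powr (x - 1) / (of_real (1 + u) :: complex) powr (x + y)"
  proof -
    have "(of_real (1 + u) :: complex) powr (x + y) =
        of_real (1 + u) powr ((x - 1) + (y - 1) + 1 + 1)"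
      by simp
    also have "\<dots> = of_real (1 + u) powr (x - 1) * of_real (1 + u) powr (y - 1) * (of_real (1 + u))\<^sup>2"
      unfolding powr_add using assms by (simp add: power2_eq_square)
    finally show ?thesis
      using assms by (subst (1 2) pw) (simp_all add: one power2_eq_square)
  qed
  show ?thesis
    unfolding Psi_beta_halfline_integrand_def Psi_beta_integrand_def scaleR_conv_of_real
      compl arg weight[symmetric]
    by (simp only: mult_ac)
qed

text \<open>Since \<open>cos\<^sup>2\<close> decreases on \<open>{0..pi / 2}\<close>, the interval is first reflected by \<open>t \<mapsto> 1 - t\<close>; then the
  increasing map \<open>sin\<^sup>2\<close> is substituted.\<close>

lemma has_integral_Psi_beta_trig_iff:
  "(Psi_beta_integrand p \<alpha> \<beta> x y has_integral I) {0<..<1} \<longleftrightarrow>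
   ((\<lambda>\<theta>. 2 * Psi_beta_trig_integrand p \<alpha> \<beta> x y \<theta>) has_integral I) {0<..<pi / 2}"
proof -
  let ?f = "Psi_beta_integrand p \<alpha> \<beta> x y"
  have "(?f has_integral I) {0<..<1} \<longleftrightarrow> ((\<lambda>t. ?f (1 - t)) has_integral I) {0<..<1}"
  proof -
    have refl: "((\<lambda>t. g (1 - t)) has_integral I) {0<..<1}" if "(g has_integral I) {0<..<1}"
      for g :: "real \<Rightarrow> complex"
      using has_integral_affinity[of g I 0 "1::real" "-1" 1] that
      by (simp add: has_integral_Icc_iff_Ioo[symmetric] image_affinity_atLeastAtMost)
    from refl[of ?f] refl[of "\<lambda>t. ?f (1 - t)"] show ?thesis by auto
  qed
  also have "\<dots> \<longleftrightarrow> ((\<lambda>\<theta>. (2 * sin \<theta> * cos \<theta>) *\<^sub>R ?f (1 - (sin \<theta>)\<^sup>2)) has_integral I) {0<..<pi / 2}"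
  proof -
    have "((\<lambda>t. ?f (1 - t)) has_integral I) {(sin 0)\<^sup>2<..<(sin (pi / 2))\<^sup>2} \<longleftrightarrow>
        ((\<lambda>\<theta>. (2 * sin \<theta> * cos \<theta>) *\<^sub>R ?f (1 - (sin \<theta>)\<^sup>2)) has_integral I) {0<..<pi / 2}"
    proof (rule has_integral_substitution_increasing_iff)
      show "continuous_on {0..pi / 2} (\<lambda>\<theta>. (sin \<theta>)\<^sup>2 :: real)"
        by (intro continuous_intros)
      fix \<theta> :: real assume "0 < \<theta>" "\<theta> < pi / 2"
      then show "2 * sin \<theta> * cos \<theta> > 0"
        by (intro mult_pos_pos sin_gt_zero2 cos_gt_zero) auto
      show "((\<lambda>\<theta>. (sin \<theta>)\<^sup>2) has_real_derivative 2 * sin \<theta> * cos \<theta>) (at \<theta>)"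
        by (auto intro!: derivative_eq_intros)
    qed simp
    then show ?thesis by simp
  qed
  also have "\<dots> \<longleftrightarrow> ((\<lambda>\<theta>. 2 * Psi_beta_trig_integrand p \<alpha> \<beta> x y \<theta>) has_integral I) {0<..<pi / 2}"
    by (rule has_integral_cong) (simp add: trig_integrand_eq)
  finally show ?thesis .
qed

text \<open>The maps \<open>u \<mapsto> u / (1 + u)\<close> and \<open>t \<mapsto> t / (1 - t)\<close> are inverse to each other and exchange the
  limits \<open>u \<rightarrow> \<infinity>\<close> and \<open>t \<rightarrow> 1\<close>, so the two improper integrals have the same partial integrals.\<close>

lemma has_integral_Psi_beta_halfline_iff:
  "(Psi_beta_integrand p \<alpha> \<beta> x y has_integral I) {0<..<1} \<longleftrightarrow>
   (Psi_beta_halfline_integrand p \<alpha> \<beta> x y has_integral I) {0<..}"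
proof -
  let ?f = "Psi_beta_integrand p \<alpha> \<beta> x y"
  let ?g = "Psi_beta_halfline_integrand p \<alpha> \<beta> x y"
  define h :: "real \<Rightarrow> real" where "h u = u / (1 + u)" for u
  define k :: "real \<Rightarrow> real" where "k t = t / (1 - t)" for t
  have sub: "(?f has_integral J) {0..h T} \<longleftrightarrow> (?g has_integral J) {0..T}" if "T > 0" for J T
  proof -
    have "h 0 = 0" by (simp add: h_def)
    have "(?f has_integral J) {h 0<..<h T} \<longleftrightarrow>
        ((\<lambda>u. (1 / (1 + u)\<^sup>2) *\<^sub>R ?f (h u)) has_integral J) {0<..<T}"
    proof (rule has_integral_substitution_increasing_iff[OF \<open>T > 0\<close>])
      show "continuous_on {0..T} h"
        unfolding h_def by (intro continuous_intros) auto
      show "(h has_real_derivative 1 / (1 + s)\<^sup>2) (at s)" if "0 < s" "s < T" for s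
        unfolding h_def using that
        by (auto intro!: derivative_eq_intros simp: field_simps power2_eq_square)
    qed auto
    also have "\<dots> \<longleftrightarrow> (?g has_integral J) {0<..<T}"
      by (rule has_integral_cong) (simp add: halfline_integrand_eq h_def)
    finally show ?thesis
      by (simp add: has_integral_Icc_iff_Ioo \<open>h 0 = 0\<close>)
  qed
  have h: "0 < h T \<and> h T < 1 \<and> k (h T) = T" if "T > 0" for T
    using that by (simp add: h_def k_def field_simps)
  have k: "0 < k t \<and> h (k t) = t" if "0 < t" "t < 1" for t
    using that by (simp add: h_def k_def field_simps)
  note eq = integrable_integral_eq_of_has_integral_iff[OF sub]
  have "(\<forall>t. 0 < t \<and> t < 1 \<longrightarrow> ?f integrable_on {0..t}) \<longleftrightarrow> (\<forall>T>0. ?g integrable_on {0..T})"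
    using eq(1) h k by metis
  moreover have "((\<lambda>t. integral {0..t} ?f) \<longlongrightarrow> I) (at_left 1) \<longleftrightarrow>
      ((\<lambda>T. integral {0..T} ?g) \<longlongrightarrow> I) at_top"
  proof
    assume "((\<lambda>t. integral {0..t} ?f) \<longlongrightarrow> I) (at_left 1)"
    moreover have "filterlim h (at_left 1) at_top"
      unfolding h_def by real_asymp
    ultimately have "((\<lambda>T. integral {0..h T} ?f) \<longlongrightarrow> I) at_top"
      by (rule filterlim_compose)
    moreover have "eventually (\<lambda>T. integral {0..h T} ?f = integral {0..T} ?g) at_top"
      using eventually_gt_at_top[of 0] by eventually_elim (rule eq(2))
    ultimately show "((\<lambda>T. integral {0..T} ?g) \<longlongrightarrow> I) at_top"
      by (rule Lim_transform_eventually)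
  next
    assume "((\<lambda>T. integral {0..T} ?g) \<longlongrightarrow> I) at_top"
    moreover have "filterlim k at_top (at_left 1)"
      unfolding k_def by real_asymp
    ultimately have "((\<lambda>t. integral {0..k t} ?g) \<longlongrightarrow> I) (at_left 1)"
      by (rule filterlim_compose)
    moreover have "eventually (\<lambda>t. integral {0..k t} ?g = integral {0..t} ?f) (at_left 1)"
      using eventually_at_left_real[OF zero_less_one]
      by eventually_elim (use eq(2) k in force)
    ultimately show "((\<lambda>t. integral {0..t} ?f) \<longlongrightarrow> I) (at_left 1)"
      by (rule Lim_transform_eventually)
  qed
  ultimately show ?thesis
    unfolding has_integral_Ioo_iff_improper[OF zero_less_one] has_integral_Ioi_iff_improper by blast
qed

theorem theorem2p3:
  fixes \<alpha> \<beta> x y p :: complex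
  assumes "Re x > 0" and "Re y > 0" and "Re \<alpha> > -1" and "Re p > 0"
  shows "(Psi_beta_integrand p \<alpha> \<beta> x y integrable_on {0<..<1} \<longleftrightarrow>
            Psi_beta_trig_integrand p \<alpha> \<beta> x y integrable_on {0<..<pi / 2}) \<and>
         Psi_beta p \<alpha> \<beta> x y =
           2 * integral {0<..<pi / 2} (Psi_beta_trig_integrand p \<alpha> \<beta> x y) \<and>
         (Psi_beta_integrand p \<alpha> \<beta> x y integrable_on {0<..<1} \<longleftrightarrow>
            Psi_beta_halfline_integrand p \<alpha> \<beta> x y integrable_on {0<..}) \<and>
         Psi_beta p \<alpha> \<beta> x y =
           integral {0<..} (Psi_beta_halfline_integrand p \<alpha> \<beta> x y)"
proof -
  let ?g = "Psi_beta_trig_integrand p \<alpha> \<beta> x y"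
  note trig = integrable_integral_eq_of_has_integral_iff[OF has_integral_Psi_beta_trig_iff]
  note halfline = integrable_integral_eq_of_has_integral_iff[OF has_integral_Psi_beta_halfline_iff]
  have "(\<lambda>\<theta>. 2 * ?g \<theta>) integrable_on {0<..<pi / 2} \<longleftrightarrow> ?g integrable_on {0<..<pi / 2}"
    by simp
  moreover have "integral {0<..<pi / 2} (\<lambda>\<theta>. 2 * ?g \<theta>) = 2 * integral {0<..<pi / 2} ?g"
    by (rule Henstock_Kurzweil_Integration.integral_mult_right)
  ultimately show ?thesis
    unfolding Psi_beta_def using trig halfline by simp
qed

end
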